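(* Let $p$ be a prime and let $m\ge1$, $k\ge2$ be integers. Then for $G=\mathbb{Z}_{p^m}$, $$p^{1/k}-1\le f^{(D)}_G(k)=f^{(D)}(p,k).$$
   Context: For a finite abelian group $G$ (written additively) and a non-empty set $A\subseteq\mathbb{Z}\setminus\{0\}$, the weighted Davenport constant $D_A(G)$ is the least positive integer $k$ such that for every sequence $(x_1,\ldots,x_k)$ of elements of $G$ there exist a non-empty subsequence $(x_{i_1},\ldots,x_{i_t})$ and elements $a_1,\ldots,a_t\in A$ with $\sum_{j=1}^t a_jx_{i_j}=0$. For $G$ of exponent $n$ and an integer $k\ge 2$, $f^{(D)}_G(k):=\min\{|A|:\emptyset\ne A\subseteq[1,n-1],\ D_A(G)\le k\}$ (and $\infty$ if no such $A$ exists). For the cyclic group $\mathbb{Z}_n$ write $f^{(D)}(n,k):=f^{(D)}_{\mathbb{Z}_n}(k)$. *)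

theory Defs
  imports
    "HOL-Library.Extended_Real"
    "HOL-Computational_Algebra.Primes"
    "HOL-Algebra.Elementary_Groups"
    "HOL-Algebra.FiniteProduct"
begin

(* Groups from HOL-Algebra are written multiplicatively, so the weighted sum
   a_1 x_1 + ... + a_t x_t is a product of integer powers.  The group is abelian, so a
   subsequence is given by its set I of indices.  For finite G and nonempty A such a k exists,
   so LEAST is the true minimum. *)
definition weighted_davenport :: "int set \<Rightarrow> ('a, 'b) monoid_scheme \<Rightarrow> nat" where
  "weighted_davenport A G = (LEAST k. 0 < k \<and>
     (\<forall>x \<in> {1..k} \<rightarrow> carrier G. \<exists>I a. I \<noteq> {} \<and> I \<subseteq> {1..k} \<and> a \<in> I \<rightarrow> A \<and>
        (\<Otimes>\<^bsub>G\<^esub>i\<in>I. x i [^]\<^bsub>G\<^esub> (a i :: int)) = \<one>\<^bsub>G\<^esub>))"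

definition group_exponent :: "('a, 'b) monoid_scheme \<Rightarrow> nat" where
  "group_exponent G = (LEAST n. 0 < n \<and> (\<forall>x\<in>carrier G. x [^]\<^bsub>G\<^esub> n = \<one>\<^bsub>G\<^esub>))"

(* In enat the infimum of a nonempty set is its minimum, and Inf {} = \<infinity>. *)
definition fD :: "('a, 'b) monoid_scheme \<Rightarrow> nat \<Rightarrow> enat" where
  "fD G k = Inf {enat (card A) | A.
     A \<noteq> {} \<and> A \<subseteq> {1..int (group_exponent G) - 1} \<and> weighted_davenport A G \<le> k}"

abbreviation fD_cyclic :: "nat \<Rightarrow> nat \<Rightarrow> enat" where
  "fD_cyclic n k \<equiv> fD (integer_mod_group n) k"

end

(* Write S(A,n,k) for: every x in Z^k has a nonempty subsequence with an A-weighted sum divisible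
   by n.  If S(A,p,k) holds, then S(p^(m-1) A, p^m, k) holds.  Conversely, in an A-weighted sum
   divisible by p^m, divide by the least p-power occurring in the weights and reduce mod p: only
   the terms of least p-adic valuation survive, and their weights become the p-free parts of the
   original ones.  Hence both minima agree.  For the lower bound, each of the fewer than
   (|A| + 1)^k nonzero coefficient vectors in (A \<union> {0})^k annihilates at most p^(k-1) vectors
   of Z_p^k, and together they must annihilate all of them. *)

theory Submission
  imports Defs
begin

section \<open>Weighted zero-sums of integers modulo \<open>n\<close>, and the cyclic group in these
  terms\<close>

text \<open>Here \<open>x\<close> is an integer vector rather than a vector of residues, so that
  powers of a prime can be cancelled from a weighted sum. Only its values on \<open>{1..k}\<close>
  matter.\<close>

definition zero_sum :: "int set \<Rightarrow> nat \<Rightarrow> nat \<Rightarrow> bool" where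
  "zero_sum A n k \<longleftrightarrow> (\<forall>x. \<exists>I a. I \<noteq> {} \<and> I \<subseteq> {1..k} \<and> a \<in> I \<rightarrow> A \<and>
     int n dvd (\<Sum>i\<in>I. a i * x i))"

lemma zero_sum_mono: "zero_sum A n k \<Longrightarrow> k \<le> l \<Longrightarrow> zero_sum A n l"
  unfolding zero_sum_def by (meson atLeastatMost_subset_iff order.refl order.trans)

lemma finprod_integer_mod_group:
  assumes "n > 0" "f \<in> I \<rightarrow> carrier (integer_mod_group n)"
  shows "(\<Otimes>\<^bsub>integer_mod_group n\<^esub>i\<in>I. f i) = (\<Sum>i\<in>I. f i) mod int n"
proof -
  interpret comm_group "integer_mod_group n" by simp
  show ?thesis
    using assms(2)
  proof (induction I rule: infinite_finite_induct)
    case (insert j I)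
    then show ?case by (subst finprod_insert) (auto simp: mod_add_right_eq)
  qed simp_all
qed

text \<open>Replacing each entry of \<open>x\<close> by its residue changes no weighted sum modulo
  \<open>n\<close>, so quantifying over all integers or over residues is the same.\<close>

lemma zero_sum_iff_integer_mod_group:
  assumes "n > 0"
  shows "zero_sum A n k \<longleftrightarrow>
    (\<forall>x \<in> {1..k} \<rightarrow> carrier (integer_mod_group n). \<exists>I a. I \<noteq> {} \<and> I \<subseteq> {1..k} \<and> a \<in> I \<rightarrow> A \<and>
      (\<Otimes>\<^bsub>integer_mod_group n\<^esub>i\<in>I. x i [^]\<^bsub>integer_mod_group n\<^esub> (a i :: int))
        = \<one>\<^bsub>integer_mod_group n\<^esub>)"
proof -
  have prod: "(\<Otimes>\<^bsub>integer_mod_group n\<^esub>i\<in>I. x i [^]\<^bsub>integer_mod_group n\<^esub> (a i :: int))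
      = \<one>\<^bsub>integer_mod_group n\<^esub> \<longleftrightarrow> int n dvd (\<Sum>i\<in>I. a i * x i)" for I :: "nat set" and a x
    using assms
    by (subst finprod_integer_mod_group)
       (auto simp: int_pow_integer_mod_group carrier_integer_mod_group mod_sum_eq dvd_eq_mod_eq_0)
  have reduce: "int n dvd (\<Sum>i\<in>I. a i * (x i mod int n)) \<longleftrightarrow> int n dvd (\<Sum>i\<in>I. a i * x i)"
    for I :: "nat set" and a x
  proof -
    have "(\<Sum>i\<in>I. a i * (x i mod int n)) mod int n = (\<Sum>i\<in>I. a i * x i) mod int n"
      by (subst (1 2) mod_sum_eq [symmetric]) (simp add: mod_mult_right_eq)
    then show ?thesis by (simp add: dvd_eq_mod_eq_0)
  qed
  show ?thesis
    unfolding zero_sum_def prod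
  proof (intro iffI ballI allI, blast)
    fix x
    assume *: "\<forall>x\<in>{1..k} \<rightarrow> carrier (integer_mod_group n). \<exists>I a. I \<noteq> {} \<and> I \<subseteq> {1..k} \<and>
      a \<in> I \<rightarrow> A \<and> int n dvd (\<Sum>i\<in>I. a i * x i)"
    have "(\<lambda>i. x i mod int n) \<in> {1..k} \<rightarrow> carrier (integer_mod_group n)"
      using assms by (auto simp: carrier_integer_mod_group)
    from bspec [OF * this] show "\<exists>I a. I \<noteq> {} \<and> I \<subseteq> {1..k} \<and> a \<in> I \<rightarrow> A \<and>
      int n dvd (\<Sum>i\<in>I. a i * x i)"
      unfolding reduce .
  qed
qed

text \<open>Two of the \<open>n + 1\<close> prefix sums, the empty one included, agree modulo
  \<open>n\<close>; the block between them sums to zero, and so does its multiple by one fixed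
  weight. This makes the \<open>LEAST\<close> in \<open>weighted_davenport\<close>
  meaningful.\<close>

lemma zero_sum_self:
  assumes "n > 0" "A \<noteq> {}"
  shows "zero_sum A n n"
  unfolding zero_sum_def
proof
  fix x :: "nat \<Rightarrow> int"
  obtain b where b: "b \<in> A" using assms by blast
  define s where "s j = (\<Sum>i\<in>{1..j}. x i)" for j
  have "\<not> inj_on (\<lambda>j. s j mod int n) {0..n}"
  proof (rule pigeonhole)
    have "(\<lambda>j. s j mod int n) ` {0..n} \<subseteq> {0..<int n}" using assms by auto
    then have "card ((\<lambda>j. s j mod int n) ` {0..n}) \<le> card {0..<int n}"
      by (intro card_mono) auto
    then show "card ((\<lambda>j. s j mod int n) ` {0..n}) < card {0..n}" by simp
  qed
  then obtain i j where ij: "i < j" "j \<le> n" "s i mod int n = s j mod int n"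
    unfolding inj_on_def by (metis atLeastAtMost_iff linorder_neqE_nat)
  have "{1..j} = {1..i} \<union> {Suc i..j}" using ij by auto
  then have "s j = s i + (\<Sum>l\<in>{Suc i..j}. x l)"
    unfolding s_def by (simp add: sum.union_disjoint)
  then have "int n dvd (\<Sum>l\<in>{Suc i..j}. x l)"
    using ij(3) by (metis add_diff_cancel_left' mod_eq_dvd_iff)
  then have "int n dvd (\<Sum>l\<in>{Suc i..j}. b * x l)"
    by (simp flip: sum_distrib_left)
  then show "\<exists>I a. I \<noteq> {} \<and> I \<subseteq> {1..n} \<and> a \<in> I \<rightarrow> A \<and> int n dvd (\<Sum>i\<in>I. a i * x i)"
    using ij b by (intro exI [of _ "{Suc i..j}"] exI [of _ "\<lambda>_. b"]) auto
qed

text \<open>The least length exists by \<open>zero_sum_self\<close>, and by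
  \<open>zero_sum_mono\<close> every larger length works too.\<close>

lemma weighted_davenport_le_iff:
  assumes "n > 0" "A \<noteq> {}" "k > 0"
  shows "weighted_davenport A (integer_mod_group n) \<le> k \<longleftrightarrow> zero_sum A n k"
proof -
  have eq: "weighted_davenport A (integer_mod_group n) = (LEAST k. 0 < k \<and> zero_sum A n k)"
    by (simp only: weighted_davenport_def zero_sum_iff_integer_mod_group [OF assms(1)])
  have "zero_sum A n (weighted_davenport A (integer_mod_group n))"
    unfolding eq using LeastI [of "\<lambda>k. 0 < k \<and> zero_sum A n k" n] zero_sum_self assms by blast
  then show ?thesis
    using zero_sum_mono assms(3) Least_le [of "\<lambda>k. 0 < k \<and> zero_sum A n k" k] eq by metis
qed

lemma group_exponent_integer_mod_group:
  assumes "n > 1"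
  shows "group_exponent (integer_mod_group n) = n"
  unfolding group_exponent_def
proof (rule Least_equality)
  fix l :: nat
  assume l: "0 < l \<and> (\<forall>x\<in>carrier (integer_mod_group n). x [^]\<^bsub>integer_mod_group n\<^esub> l
    = \<one>\<^bsub>integer_mod_group n\<^esub>)"
  \<comment> \<open>The generator 1 alone forces \<open>n\<close> to divide
    \<open>l\<close>.\<close>
  moreover have "1 \<in> carrier (integer_mod_group n)" using assms by simp
  ultimately have "int l mod int n = 0" by fastforce
  then show "n \<le> l" using l by (metis dvd_eq_mod_eq_0 dvd_imp_le of_nat_dvd_iff)
qed (use assms in auto)

lemma fD_integer_mod_group:
  assumes "n > 1" "k > 0"
  shows "fD (integer_mod_group n) k
    = Inf {enat (card A) | A. A \<noteq> {} \<and> A \<subseteq> {1..int n - 1} \<and> zero_sum A n k}"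
  unfolding fD_def group_exponent_integer_mod_group [OF assms(1)]
  using assms by (simp add: weighted_davenport_le_iff cong: conj_cong)

section \<open>Transfer of weight sets between the moduli \<open>p\<close> and
  \<open>p ^ m\<close>\<close>

lemma zero_sum_mult:
  assumes "zero_sum A n k"
  shows "zero_sum ((*) (int c) ` A) (c * n) k"
  unfolding zero_sum_def
proof
  fix x
  obtain I a where I: "I \<noteq> {}" "I \<subseteq> {1..k}" "a \<in> I \<rightarrow> A" "int n dvd (\<Sum>i\<in>I. a i * x i)"
    using assms [unfolded zero_sum_def, THEN spec, of x] by blast
  have "(\<Sum>i\<in>I. int c * a i * x i) = int c * (\<Sum>i\<in>I. a i * x i)"
    by (simp add: sum_distrib_left mult.assoc)
  then show "\<exists>I a. I \<noteq> {} \<and> I \<subseteq> {1..k} \<and> a \<in> I \<rightarrow> (*) (int c) ` A \<and>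
      int (c * n) dvd (\<Sum>i\<in>I. a i * x i)"
    using I by (intro exI [of _ I] exI [of _ "\<lambda>i. int c * a i"]) (auto intro: mult_dvd_mono)
qed

text \<open>The \<open>p\<close>-free part of a weight, reduced modulo \<open>p\<close>. It depends
  on that weight alone, so passing from \<open>A\<close> to its image cannot increase the
  cardinality.\<close>

definition unit_part :: "nat \<Rightarrow> int \<Rightarrow> int" where
  "unit_part p a = a div int p ^ multiplicity (int p) a mod int p"

lemma unit_part_in:
  assumes "prime p" "a \<noteq> 0"
  shows "unit_part p a \<in> {1..int p - 1}"
proof -
  have "\<not> int p dvd a div int p ^ multiplicity (int p) a"
    using assms by (intro multiplicity_decompose) (auto simp: prime_gt_1_nat)
  then have "unit_part p a \<noteq> 0" by (auto simp: unit_part_def dvd_eq_mod_eq_0)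
  moreover have "0 \<le> unit_part p a" "unit_part p a < int p"
    using assms(1) by (auto simp: unit_part_def prime_gt_0_nat)
  ultimately show ?thesis by auto
qed

lemma zero_sum_unit_part:
  assumes "prime p" "A \<subseteq> {1..int (p ^ m) - 1}" "zero_sum A (p ^ m) k"
  shows "zero_sum (unit_part p ` A) p k"
  unfolding zero_sum_def
proof
  fix x
  obtain I a where I: "I \<noteq> {}" "I \<subseteq> {1..k}" "a \<in> I \<rightarrow> A"
    and dvd: "int (p ^ m) dvd (\<Sum>i\<in>I. a i * x i)"
    using assms(3) [unfolded zero_sum_def, THEN spec, of x] by blast
  define val where "val i = multiplicity (int p) (a i)" for i
  \<comment> \<open>\<open>v\<close> is the least valuation among the weights used, \<open>J\<close>
    the set of indices attaining it, and \<open>c\<close> what remains of the weights after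
    cancelling \<open>p ^ v\<close>.\<close>
  define v where "v = Min (val ` I)"
  define J where "J = {i \<in> I. val i = v}"
  define c where "c i = a i div int p ^ v" for i
  have fin: "finite I" using I finite_subset by blast
  have p: "int p \<noteq> 0" "\<not> is_unit (int p)" using assms(1) by (auto simp: prime_gt_1_nat)
  have a0: "a i \<noteq> 0" "0 < a i" "a i < int p ^ m" if "i \<in> I" for i
    using that I assms(2) by fastforce+
  have le: "v \<le> val i" if "i \<in> I" for i
    using that fin by (simp add: v_def)
  have "v \<in> val ` I" unfolding v_def using fin I by (intro Min_in) auto
  then obtain j where j: "j \<in> I" "val j = v" by blast
  have "J \<noteq> {}" using j by (auto simp: J_def)
  have "int p ^ v dvd a j" using j multiplicity_dvd unfolding val_def by blast
  \<comment> \<open>The range of \<open>A\<close> matters here: a positive weight below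
    \<open>p ^ m\<close> is divisible by \<open>p ^ v\<close>, so a factor \<open>p\<close> of the
    modulus survives the cancellation.\<close>
  then have "int p ^ v < int p ^ m" using a0 [OF j(1)] zdvd_imp_le by fastforce
  then have "v < m" using prime_gt_1_nat [OF assms(1)] by simp
  have ac: "a i = int p ^ v * c i" if "i \<in> I" for i
    using le [OF that] unfolding c_def val_def by (simp add: multiplicity_dvd')
  have "int p ^ Suc v dvd int (p ^ m)"
    using \<open>v < m\<close> by (simp add: le_imp_power_dvd Suc_leI del: power_Suc)
  then have "int p ^ Suc v dvd (\<Sum>i\<in>I. a i * x i)" using dvd dvd_trans by blast
  also have "(\<Sum>i\<in>I. a i * x i) = int p ^ v * (\<Sum>i\<in>I. c i * x i)"
    by (simp add: sum_distrib_left ac mult.assoc)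
  finally have "int p dvd (\<Sum>i\<in>I. c i * x i)" using p by simp
  \<comment> \<open>Outside \<open>J\<close> the valuation is at least \<open>v + 1\<close>, so
    these terms vanish modulo \<open>p\<close>.\<close>
  moreover have "int p dvd (\<Sum>i\<in>I - J. c i * x i)"
  proof (rule dvd_sum)
    fix i assume i: "i \<in> I - J"
    then have "Suc v \<le> val i" using le by (force simp: J_def)
    then have "int p ^ Suc v dvd a i" unfolding val_def by (rule multiplicity_dvd')
    then have "int p dvd c i" using ac [of i] i p by simp
    then show "int p dvd c i * x i" by simp
  qed
  moreover have "(\<Sum>i\<in>I. c i * x i) = (\<Sum>i\<in>I - J. c i * x i) + (\<Sum>i\<in>J. c i * x i)"
    using fin by (intro sum.subset_diff) (auto simp: J_def)
  ultimately have "int p dvd (\<Sum>i\<in>J. c i * x i)" by (simp add: dvd_add_right_iff)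
  moreover have "(\<Sum>i\<in>J. unit_part p (a i) * x i) mod int p = (\<Sum>i\<in>J. c i * x i) mod int p"
  proof -
    \<comment> \<open>On \<open>J\<close> the valuation is exactly \<open>v\<close>, so
      \<open>c i\<close> is the \<open>p\<close>-free part of \<open>a i\<close>.\<close>
    have "unit_part p (a i) = c i mod int p" if "i \<in> J" for i
      using that by (simp add: unit_part_def J_def c_def val_def)
    then show ?thesis
      by (subst (1 2) mod_sum_eq [symmetric]) (simp add: mod_mult_left_eq)
  qed
  ultimately have "int p dvd (\<Sum>i\<in>J. unit_part p (a i) * x i)"
    by (simp add: dvd_eq_mod_eq_0)
  then show "\<exists>I a. I \<noteq> {} \<and> I \<subseteq> {1..k} \<and> a \<in> I \<rightarrow> unit_part p ` A \<and>
      int p dvd (\<Sum>i\<in>I. a i * x i)"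
    using I \<open>J \<noteq> {}\<close>
    by (intro exI [of _ J] exI [of _ "\<lambda>i. unit_part p (a i)"]) (auto simp: J_def)
qed

section \<open>Lower bound by covering the vectors modulo \<open>p\<close> with hyperplanes\<close>

text \<open>As \<open>c j\<close> is invertible modulo \<open>p\<close>, the other coordinates of a
  solution determine \<open>x j\<close>; hence forgetting coordinate \<open>j\<close> is injective
  on solutions.\<close>

lemma card_hyperplane_le:
  fixes c :: "'a \<Rightarrow> int"
  assumes "prime p" "finite K" "j \<in> K" "\<not> int p dvd c j"
  shows "card {x \<in> K \<rightarrow>\<^sub>E {0..<int p}. int p dvd (\<Sum>i\<in>K. c i * x i)} \<le> p ^ (card K - 1)"
    (is "card ?H \<le> _")
proof -
  have "inj_on (\<lambda>x. restrict x (K - {j})) ?H"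
  proof (rule inj_onI)
    fix x y
    assume x: "x \<in> ?H" and y: "y \<in> ?H" and eq: "restrict x (K - {j}) = restrict y (K - {j})"
    have off: "x i = y i" if "i \<noteq> j" for i
    proof (cases "i \<in> K")
      case True
      then show ?thesis using that fun_cong [OF eq, of i] by simp
    next
      case False
      then show ?thesis using x y by (auto simp: PiE_def extensional_def)
    qed
    have "int p dvd (\<Sum>i\<in>K. c i * x i) - (\<Sum>i\<in>K. c i * y i)"
      using x y by (intro dvd_diff) auto
    also have "(\<Sum>i\<in>K. c i * x i) - (\<Sum>i\<in>K. c i * y i) = c j * (x j - y j)"
      using assms off by (simp add: sum.remove [OF assms(2,3)] algebra_simps)
    finally have "int p dvd x j - y j"
      using assms by (simp add: prime_dvd_mult_iff)
    then have "x j mod int p = y j mod int p" by (simp add: mod_eq_dvd_iff)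
    moreover have "x j \<in> {0..<int p}" "y j \<in> {0..<int p}"
      using x y assms(3) by (auto dest!: PiE_mem)
    ultimately have "x j = y j" by simp
    then show "x = y" using off by (metis ext)
  qed
  moreover have "(\<lambda>x. restrict x (K - {j})) ` ?H \<subseteq> (K - {j}) \<rightarrow>\<^sub>E {0..<int p}"
    by (auto intro!: restrict_PiE_iff [THEN iffD2] dest: PiE_mem)
  ultimately have "card ?H \<le> card ((K - {j}) \<rightarrow>\<^sub>E {0..<int p})"
    using assms(2) by (intro card_inj_on_le finite_PiE) auto
  also have "\<dots> = p ^ (card K - 1)"
    using assms by (simp add: card_PiE)
  finally show ?thesis .
qed

lemma zero_sum_card_bound:
  assumes "prime p" "k > 0" "A \<subseteq> {1..int p - 1}" "zero_sum A p k"
  shows "p \<le> (card A + 1) ^ k"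
proof -
  define H where "H c = {x \<in> {1..k} \<rightarrow>\<^sub>E {0..<int p}. int p dvd (\<Sum>i\<in>{1..k}. c i * x i)}"
    for c :: "nat \<Rightarrow> int"
  \<comment> \<open>The entry 0 encodes an omitted index. Since 0 is not in \<open>A\<close>, the
    condition on \<open>j\<close> excludes exactly the zero vector, whose solution set would be
    everything.\<close>
  define C where "C = {c \<in> {1..k} \<rightarrow>\<^sub>E insert 0 A. \<exists>j\<in>{1..k}. c j \<in> A}"
  have finA: "finite A" using assms(3) finite_subset by blast
  have "0 \<notin> A" using assms(3) by auto
  have finC: "finite C" unfolding C_def using finA by (simp add: finite_PiE)
  have cover: "{1..k} \<rightarrow>\<^sub>E {0..<int p} \<subseteq> (\<Union>c\<in>C. H c)"
  proof
    fix x
    assume x: "x \<in> {1..k} \<rightarrow>\<^sub>E {0..<int p}"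
    obtain I a where I: "I \<noteq> {}" "I \<subseteq> {1..k}" "a \<in> I \<rightarrow> A" "int p dvd (\<Sum>i\<in>I. a i * x i)"
      using assms(4) [unfolded zero_sum_def, THEN spec, of x] by blast
    \<comment> \<open>Padding the weights by 0 off \<open>I\<close> turns the zero-sum of
      \<open>x\<close> into membership in a hyperplane.\<close>
    define c where "c = (\<lambda>i\<in>{1..k}. if i \<in> I then a i else 0)"
    obtain j where "j \<in> I" using I by blast
    then have "c j \<in> A" "j \<in> {1..k}" using I by (auto simp: c_def)
    moreover have "c \<in> {1..k} \<rightarrow>\<^sub>E insert 0 A" using I by (auto simp: c_def Pi_iff)
    ultimately have "c \<in> C" unfolding C_def by blast
    moreover have "(\<Sum>i\<in>{1..k}. c i * x i) = (\<Sum>i\<in>I. a i * x i)"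
      using I by (intro sum.mono_neutral_cong_right) (auto simp: c_def)
    ultimately show "x \<in> (\<Union>c\<in>C. H c)"
      using I(4) x unfolding H_def by (intro UN_I [of c]) simp_all
  qed
  have bound: "card (H c) \<le> p ^ (k - 1)" if cC: "c \<in> C" for c
  proof -
    \<comment> \<open>An element of \<open>A\<close> lies strictly between 0 and \<open>p\<close>,
      hence is a unit modulo \<open>p\<close>.\<close>
    obtain j where "j \<in> {1..k}" "c j \<in> A" using cC unfolding C_def by blast
    moreover from this have "\<not> int p dvd c j"
      using assms(3) zdvd_not_zless [of "c j" "int p"] by auto
    ultimately show ?thesis
      using card_hyperplane_le [OF assms(1), of "{1..k}" j c] by (simp add: H_def)
  qed
  have "p ^ k = card ({1..k} \<rightarrow>\<^sub>E {0..<int p})" by (simp add: card_PiE)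
  also have "\<dots> \<le> card (\<Union>c\<in>C. H c)"
    using cover finC by (intro card_mono) (auto simp: H_def finite_PiE)
  also have "\<dots> \<le> (\<Sum>c\<in>C. card (H c))" by (rule card_UN_le [OF finC])
  also have "\<dots> \<le> card C * p ^ (k - 1)" using sum_bounded_above [of C, OF bound] by simp
  \<comment> \<open>Cancelling \<open>p ^ (k - 1)\<close> shows that at least \<open>p\<close>
    hyperplanes are needed.\<close>
  finally have "p * p ^ (k - 1) \<le> card C * p ^ (k - 1)"
    using assms(2) by (simp flip: power_Suc)
  then have "p \<le> card C" using assms(1) by (simp add: prime_gt_0_nat)
  also have "\<dots> \<le> card ({1..k} \<rightarrow>\<^sub>E insert 0 A)"
    using finA by (intro card_mono) (auto simp: C_def finite_PiE)
  also have "\<dots> = (card A + 1) ^ k" using finA \<open>0 \<notin> A\<close> by (simp add: card_PiE)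
  finally show ?thesis .
qed

text \<open>Take \<open>k\<close>-th roots. The case \<open>b = 0\<close> stands apart because
  \<open>powr_realpow\<close> wants a positive base; it forces \<open>p = 0\<close>.\<close>

lemma powr_inverse_le:
  assumes "k > 0" "p \<le> b ^ k"
  shows "real p powr (1 / real k) \<le> real b"
proof (cases "b = 0")
  case False
  have "real p powr (1 / real k) \<le> (real b ^ k) powr (1 / real k)"
    using assms(2) by (intro powr_mono2) (auto simp flip: of_nat_power)
  also have "\<dots> = real b"
    using assms False by (simp add: powr_powr flip: powr_realpow)
  finally show ?thesis .
qed (use assms in \<open>auto simp: power_0_left\<close>)

theorem theorem3:
  fixes p m k :: nat
  assumes "prime p" and "m \<ge> 1" and "k \<ge> 2"
  shows "ereal (real p powr (1 / real k) - 1) \<le> ereal_of_enat (fD (integer_mod_group (p ^ m)) k)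
    \<and> fD (integer_mod_group (p ^ m)) k = fD_cyclic p k"
proof -
  have p: "p > 1" using assms(1) prime_gt_1_nat by blast
  have k: "k > 0" using assms by simp
  have pm: "p ^ m > 1" using p assms(2) one_less_power [of p m] by simp
  let ?S = "\<lambda>n. {enat (card A) | A. A \<noteq> {} \<and> A \<subseteq> {1..int n - 1} \<and> zero_sum A n k}"
  note fD = fD_integer_mod_group [OF pm k] fD_integer_mod_group [OF p k]
  have "Inf (?S (p ^ m)) \<le> Inf (?S p)"
  proof (rule Inf_mono)
    fix e assume "e \<in> ?S p"
    then obtain A where A: "e = enat (card A)" "A \<noteq> {}" "A \<subseteq> {1..int p - 1}" "zero_sum A p k"
      by blast
    \<comment> \<open>Scaling by \<open>p ^ (m - 1)\<close> keeps the number of weights, and weights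
      below \<open>p\<close> land below \<open>p ^ m\<close>.\<close>
    let ?B = "(*) (int (p ^ (m - 1))) ` A"
    have pm': "p ^ (m - 1) * p = p ^ m"
      using assms(2) by (metis Suc_diff_1 less_eq_Suc_le One_nat_def power_Suc2)
    have "?B \<subseteq> {1..int (p ^ m) - 1}"
    proof
      fix b assume "b \<in> ?B"
      then obtain a where a: "a \<in> A" "b = int (p ^ (m - 1)) * a" by blast
      have q: "int (p ^ (m - 1)) > 0" using p by simp
      have "a > 0" "a < int p" using a A(3) by auto
      then have "0 < b" "b < int (p ^ (m - 1)) * int p"
        unfolding a(2) using q by (auto intro: mult_strict_left_mono simp del: of_nat_power)
      then show "b \<in> {1..int (p ^ m) - 1}" by (simp flip: pm')
    qed
    moreover have "zero_sum ?B (p ^ m) k"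
      using zero_sum_mult [OF A(4), of "p ^ (m - 1)"] pm' by simp
    moreover have "card ?B = card A" using p by (intro card_image) (auto simp: inj_on_def)
    ultimately show "\<exists>d\<in>?S (p ^ m). d \<le> e"
      using A by (metis (mono_tags, lifting) mem_Collect_eq image_is_empty order_refl)
  qed
  moreover have "Inf (?S p) \<le> Inf (?S (p ^ m))"
  proof (rule Inf_mono)
    fix e assume "e \<in> ?S (p ^ m)"
    then obtain A where A: "e = enat (card A)" "A \<noteq> {}" "A \<subseteq> {1..int (p ^ m) - 1}"
      "zero_sum A (p ^ m) k" by blast
    have "finite A" using A(3) finite_subset by blast
    \<comment> \<open>Distinct weights may share a unit part, so only an inequality holds; it goes
      the right way.\<close>
    then have "card (unit_part p ` A) \<le> card A" by (rule card_image_le)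
    moreover have "unit_part p ` A \<subseteq> {1..int p - 1}"
      using A(3) by (intro image_subsetI unit_part_in [OF assms(1)]) auto
    ultimately show "\<exists>d\<in>?S p. d \<le> e"
      using A zero_sum_unit_part [OF assms(1) A(3,4)]
      by (intro bexI [of _ "enat (card (unit_part p ` A))"]) auto
  qed
  ultimately have eq: "fD (integer_mod_group (p ^ m)) k = fD_cyclic p k"
    unfolding fD by (rule antisym)
  have "ereal (real p powr (1 / real k) - 1) \<le> ereal_of_enat (Inf (?S p))"
  \<comment> \<open>With no admissible set the infimum is infinite and the bound is trivial;
    otherwise some \<open>A\<close> attains it and the counting bound applies to that
    \<open>A\<close>.\<close>
  proof (cases "?S p = {}")
    case True
    then show ?thesis by (simp add: Inf_enat_def)
  next
    case False
    then have "Inf (?S p) \<in> ?S p"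
      by (metis (no_types, lifting) wellorder_InfI ex_in_conv)
    then obtain A where A: "Inf (?S p) = enat (card A)" "A \<subseteq> {1..int p - 1}" "zero_sum A p k"
      by blast
    from powr_inverse_le [OF k zero_sum_card_bound [OF assms(1) k A(2,3)]]
    show ?thesis unfolding A(1) by simp
  qed
  with eq show ?thesis unfolding fD by simp
qed

end
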